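(* Let $k,n,m\in\mathbb{Z}$ with $4\nmid m$, and let $N=\begin{pmatrix}16k+12&m\\0&16n+12\end{pmatrix}\in UT_2(\mathbb{Z})$. Then there is no Jordan $D(N)$-quadruple in $UT_2(\mathbb{Z})$.
   Context: $UT_2(\mathbb{Z})$ denotes the ring of upper-triangular $2\times 2$ integer matrices, and $A\circ B=\frac12(AB+BA)$ (computed over $\mathbb{Q}$) is the Jordan product. For $N\in UT_2(\mathbb{Z})$, a Jordan $D(N)$-quadruple in $UT_2(\mathbb{Z})$ is a set of four distinct nonzero matrices $A_1,A_2,A_3,A_4\in UT_2(\mathbb{Z})$ such that for every $1\le i<j\le 4$ there exists $X_{ij}\in UT_2(\mathbb{Z})$ with $A_i\circ A_j+N=X_{ij}^2$. *)

theory Defs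
  imports "HOL-Analysis.Analysis"
begin

text \<open>Integer matrices are represented as rational matrices with entries in \<open>\<int>\<close>, because the
  Jordan product of two integer matrices need not be integral. Matrix multiplication is \<open>**\<close>;
  the operations \<open>*\<close> and \<open>^\<close> on \<open>rat^2^2\<close> are componentwise.\<close>

definition UT2_int :: "(rat^2^2) set" where
  "UT2_int = {A. (\<forall>i j. A $ i $ j \<in> \<int>) \<and> A $ 2 $ 1 = 0}"

definition jordan_prod :: "rat^2^2 \<Rightarrow> rat^2^2 \<Rightarrow> rat^2^2" where
  "jordan_prod A B = (\<chi> i j. (1/2) * (A ** B + B ** A) $ i $ j)"

text \<open>As \<open>jordan_prod\<close> is commutative, quantifying over ordered pairs of distinct elements
  gives the same condition as quantifying over \<open>i < j\<close> in an enumeration of the set.\<close>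

definition jordan_D_quadruple :: "rat^2^2 \<Rightarrow> (rat^2^2) set \<Rightarrow> bool" where
  "jordan_D_quadruple N S \<longleftrightarrow>
     S \<subseteq> UT2_int \<and> 0 \<notin> S \<and> card S = 4 \<and>
     (\<forall>A\<in>S. \<forall>B\<in>S. A \<noteq> B \<longrightarrow> (\<exists>X\<in>UT2_int. jordan_prod A B + N = X ** X))"

end

theory Submission
  imports Defs
begin

text \<open>Comparing entries, a Jordan quadruple gives matrices with diagonals \<open>(a, c)\<close> and corner \<open>b\<close>
  such that, for any two of them, \<open>a * a' + 16 * k + 12 = x\<^sup>2\<close>, \<open>c * c' + 16 * n + 12 = z\<^sup>2\<close> and
  \<open>(a + c) * b' + (a' + c') * b + 2 * m = 2 * y * (x + z)\<close>.

  The first equation alone is very restrictive modulo 16: among four integers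
  satisfying it pairwise, all but at most one are twice odd numbers lying in one residue class
  modulo 8, and an exceptional one is \<open>4\<close> modulo 8 (\<open>square_shifted_family_mod_8\<close>). The same holds
  for the \<open>c\<close>, so at least two matrices are unexceptional in both diagonal entries. For two such
  matrices \<open>a + c\<close>, \<open>x\<close> and \<open>z\<close> are all divisible by 4, and the corner equation, with
  \<open>m\<close> not divisible by 4, forces \<open>m\<close> to be even and the two corners to have opposite parity
  (\<open>regular_pair_corner_parity\<close>). Three unexceptional matrices are therefore impossible. So there
  are exactly two of them, and some other matrix has \<open>a\<close> divisible by 4 but \<open>c\<close> twice odd; pairing
  it with either of the two makes the corner of that one even (\<open>mixed_pair_corner_even\<close>),
  contradicting the opposite parities.\<close>

section \<open>Residues modulo 16 of the diagonal entries\<close>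

lemma square_int_mod_16: "(x::int)\<^sup>2 mod 16 \<in> {0, 1, 4, 9}"
proof -
  have "\<forall>r\<in>set [0..15::int]. r\<^sup>2 mod 16 \<in> {0, 1, 4, 9}"
    by code_simp
  then have "(x mod 16)\<^sup>2 mod 16 \<in> {0, 1, 4, 9}"
    by simp
  then show ?thesis
    by (simp only: power_mod)
qed

text \<open>The product of the two numbers is \<open>x\<^sup>2 + 4\<close> modulo 16, that is, 4, 5, 8 or 13; the
  conclusions are read off the multiplication table.\<close>

lemma square_shifted_pair_residues:
  fixes a b k x :: int
  assumes "a * b + (16 * k + 12) = x\<^sup>2"
  shows "odd a \<Longrightarrow> odd b \<Longrightarrow> a * b mod 8 = 5"
    and "odd a \<Longrightarrow> even b \<Longrightarrow> 4 dvd b"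
    and "\<not> (4 dvd a \<and> 4 dvd b)"
    and "a mod 4 = 2 \<Longrightarrow> b mod 4 = 2 \<Longrightarrow> a mod 8 = b mod 8"
    and "a mod 4 = 2 \<Longrightarrow> 4 dvd b \<Longrightarrow> b mod 8 = 4"
proof -
  define r s where "r = a mod 16" and "s = b mod 16"
  have "a * b = x\<^sup>2 + 4 + 16 * (- k - 1)"
    using assms by simp
  then have "a * b mod 16 = (x\<^sup>2 + 4) mod 16"
    by (simp only: mod_mult_self2)
  also have "\<dots> = (x\<^sup>2 mod 16 + 4) mod 16"
    by (simp only: mod_add_left_eq)
  also have "\<dots> \<in> {4, 5, 8, 13}"
    using square_int_mod_16[of x] by auto
  finally have "a * b mod 16 \<in> {4, 5, 8, 13}" .
  then have mod_16: "r * s mod 16 \<in> {4, 5, 8, 13}"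
    by (simp add: r_def s_def mod_mult_eq)
  have range: "r \<in> set [0..15]" "s \<in> set [0..15]"
    by (simp_all add: r_def s_def)
  have "\<forall>r\<in>set [0..15::int]. \<forall>s\<in>set [0..15]. r * s mod 16 \<in> {4, 5, 8, 13} \<longrightarrow>
      (r mod 2 = 1 \<and> s mod 2 = 1 \<longrightarrow> r * s mod 8 = 5) \<and>
      (r mod 2 = 1 \<and> s mod 2 = 0 \<longrightarrow> s mod 4 = 0) \<and>
      \<not> (r mod 4 = 0 \<and> s mod 4 = 0) \<and>
      (r mod 4 = 2 \<and> s mod 4 = 2 \<longrightarrow> r mod 8 = s mod 8) \<and>
      (r mod 4 = 2 \<and> s mod 4 = 0 \<longrightarrow> s mod 8 = 4)"
    by code_simp
  note table = this[THEN bspec, OF range(1), THEN bspec, OF range(2), THEN mp, OF mod_16]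
  have red: "r mod 2 = a mod 2" "r mod 4 = a mod 4" "r mod 8 = a mod 8"
    "s mod 2 = b mod 2" "s mod 4 = b mod 4" "s mod 8 = b mod 8"
    by (simp_all add: r_def s_def mod_mod_cancel)
  have prod: "r * s mod 8 = a * b mod 8"
    using red(3,6) by (metis mod_mult_eq)
  note table = table[unfolded red prod]
  show "odd a \<Longrightarrow> odd b \<Longrightarrow> a * b mod 8 = 5"
    and "odd a \<Longrightarrow> even b \<Longrightarrow> 4 dvd b"
    and "\<not> (4 dvd a \<and> 4 dvd b)"
    and "a mod 4 = 2 \<Longrightarrow> b mod 4 = 2 \<Longrightarrow> a mod 8 = b mod 8"
    and "a mod 4 = 2 \<Longrightarrow> 4 dvd b \<Longrightarrow> b mod 8 = 4"
    using table by (simp_all add: odd_iff_mod_2_eq_one even_iff_mod_2_eq_zero dvd_eq_mod_eq_0)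
qed

text \<open>The product of the three pairwise products is an odd square, hence 1 modulo 8, whereas
  \<open>5 ^ 3\<close> is 5 modulo 8.\<close>

lemma not_all_pairwise_products_5_mod_8:
  fixes a b c :: int
  assumes "a * b mod 8 = 5" "a * c mod 8 = 5" "b * c mod 8 = 5"
  shows False
proof -
  have "\<forall>r\<in>set [0..7::int]. \<forall>s\<in>set [0..7]. \<forall>t\<in>set [0..7].
      \<not> (r * s mod 8 = 5 \<and> r * t mod 8 = 5 \<and> s * t mod 8 = 5)"
    by code_simp
  moreover have "a mod 8 \<in> set [0..7]" "b mod 8 \<in> set [0..7]" "c mod 8 \<in> set [0..7]"
    by simp_all
  ultimately show False
    using assms by (metis mod_mult_eq)
qed

text \<open>An odd member would make every even member divisible by 4. No three members are odd and no
  two are divisible by 4, so besides the odd one there could be only one odd and one even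
  member.\<close>

lemma square_shifted_family_even:
  fixes f :: "'i \<Rightarrow> int"
  assumes card: "card S = 4"
    and sq: "\<And>i j. i \<in> S \<Longrightarrow> j \<in> S \<Longrightarrow> i \<noteq> j \<Longrightarrow> \<exists>x. f i * f j + (16 * k + 12) = x\<^sup>2"
    and "i \<in> S"
  shows "even (f i)"
proof (rule ccontr)
  assume odd: "odd (f i)"
  have "card (S - {i}) = 3"
    using card \<open>i \<in> S\<close> by simp
  then obtain j k l where jkl: "S - {i} = {j, k, l}" "j \<noteq> k" "j \<noteq> l" "k \<noteq> l"
    by (auto simp: card_3_iff)
  have four: "4 dvd f p" if "p \<in> S - {i}" "even (f p)" for p
    using that odd sq[of i p] \<open>i \<in> S\<close> square_shifted_pair_residues(2) by blast
  have not_both_odd: "even (f p) \<or> even (f q)" if "p \<in> S - {i}" "q \<in> S - {i}" "p \<noteq> q" for p q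
  proof (rule ccontr)
    assume *: "\<not> (even (f p) \<or> even (f q))"
    have "f i * f p mod 8 = 5" "f i * f q mod 8 = 5" "f p * f q mod 8 = 5"
      using * odd that \<open>i \<in> S\<close> sq[of i p] sq[of i q] sq[of p q] square_shifted_pair_residues(1)
      by blast+
    then show False
      by (rule not_all_pairwise_products_5_mod_8)
  qed
  have not_both_four: "\<not> (4 dvd f p \<and> 4 dvd f q)" if "p \<in> S - {i}" "q \<in> S - {i}" "p \<noteq> q" for p q
    using that sq[of p q] square_shifted_pair_residues(3) by blast
  have not_both_even: "odd (f p) \<or> odd (f q)" if "p \<in> S - {i}" "q \<in> S - {i}" "p \<noteq> q" for p q
    using that not_both_four four by blast
  have "even (f j) \<noteq> even (f k)" "even (f j) \<noteq> even (f l)" "even (f k) \<noteq> even (f l)"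
    using not_both_odd[of j k] not_both_odd[of j l] not_both_odd[of k l]
      not_both_even[of j k] not_both_even[of j l] not_both_even[of k l] jkl
    by auto
  then show False
    by blast
qed

lemma square_shifted_family_mod_8:
  fixes f :: "'i \<Rightarrow> int"
  assumes card: "card S = 4"
    and sq: "\<And>i j. i \<in> S \<Longrightarrow> j \<in> S \<Longrightarrow> i \<noteq> j \<Longrightarrow> \<exists>x. f i * f j + (16 * k + 12) = x\<^sup>2"
  obtains p u where "p \<in> S" "u mod 4 = 2" "\<And>i. i \<in> S - {p} \<Longrightarrow> f i mod 8 = u mod 8"
    "f p mod 8 = u mod 8 \<or> f p mod 8 = 4"
proof -
  have dichotomy: "4 dvd f i \<or> f i mod 4 = 2" if "i \<in> S" for i
  proof -
    have "even (f i)"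
      using card sq that by (rule square_shifted_family_even)
    then show ?thesis
      by presburger
  qed
  have "\<exists>p\<in>S. \<forall>i\<in>S - {p}. f i mod 4 = 2"
  proof (cases "\<exists>p\<in>S. 4 dvd f p")
    case True
    then obtain p where p: "p \<in> S" "4 dvd f p"
      by blast
    have "f i mod 4 = 2" if "i \<in> S - {p}" for i
      using that p dichotomy[of i] sq[of p i] square_shifted_pair_residues(3) by blast
    with p show ?thesis
      by blast
  next
    case False
    moreover have "S \<noteq> {}"
      using card by auto
    ultimately show ?thesis
      using dichotomy by blast
  qed
  then obtain p where p: "p \<in> S" "\<forall>i\<in>S - {p}. f i mod 4 = 2"
    by blast
  have "card (S - {p}) = 3"
    using card p by simp
  then obtain q where q: "q \<in> S - {p}"
    by (metis card.empty ex_in_conv zero_neq_numeral)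
  show thesis
  proof
    show "p \<in> S" "f q mod 4 = 2"
      using p q by auto
    show "f i mod 8 = f q mod 8" if "i \<in> S - {p}" for i
    proof (cases "i = q")
      case False
      with that q p sq[of i q] show ?thesis
        using square_shifted_pair_residues(4) by blast
    qed simp
    obtain x where "f q * f p + (16 * k + 12) = x\<^sup>2"
      using sq[of q p] p q by blast
    note residues = square_shifted_pair_residues(4,5)[OF this \<open>f q mod 4 = 2\<close>]
    show "f p mod 8 = f q mod 8 \<or> f p mod 8 = 4"
      using dichotomy[OF p(1)] residues by auto
  qed
qed

section \<open>Parity of the corner entries\<close>

lemma four_dvd_of_square_shifted_twice_odd:
  fixes a b k x :: int
  assumes "a * b + (16 * k + 12) = x\<^sup>2" "a mod 4 = 2" "a mod 8 = b mod 8"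
  shows "4 dvd x"
proof -
  obtain q where q: "a = 4 * q + 2"
    using assms(2) by (metis mult_div_mod_eq)
  obtain t where t: "b = a + 8 * t"
    using assms(3) by (metis add_diff_cancel_left' diff_add_cancel dvdE mod_eq_dvd_iff add.commute)
  have "x\<^sup>2 = 16 * (q\<^sup>2 + q + 2 * q * t + t + k + 1)"
    using assms(1) unfolding q t by (simp add: power2_eq_square algebra_simps)
  then have "4\<^sup>2 dvd x\<^sup>2"
    by simp
  then show "4 dvd x"
    by (simp only: pow_divides_pow_iff)
qed

text \<open>Both \<open>x\<close> and \<open>z\<close> are divisible by 4, and \<open>a + c\<close> and \<open>a' + c'\<close> agree modulo 8, so the corner
  equation reads
  \<open>(a + c) * (b + b') + 2 * m \<equiv> 0\<close> modulo 8 with \<open>4 dvd a + c\<close>; if \<open>b + b'\<close> were even, it would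
  give \<open>4 dvd m\<close>.\<close>

lemma regular_pair_corner_parity:
  fixes a b c a' b' c' :: int
  assumes a: "a mod 4 = 2" "a mod 8 = a' mod 8"
    and c: "c mod 4 = 2" "c mod 8 = c' mod 8"
    and sq: "a * a' + (16 * k + 12) = x\<^sup>2" "c * c' + (16 * n + 12) = z\<^sup>2"
    and corner: "(a + c) * b' + (a' + c') * b + 2 * m = 2 * (y * (x + z))"
    and m: "\<not> 4 dvd m"
  shows "even m" "odd (b + b')"
proof -
  have "4 dvd x" "4 dvd z"
    using four_dvd_of_square_shifted_twice_odd a c sq by blast+
  then have xz: "8 dvd 2 * (y * (x + z))"
    using mult_dvd_mono[of 2 2 4 "y * (x + z)"] by simp
  have "8 dvd a' - a" "8 dvd c' - c"
    using a(2) c(2) by (simp_all only: mod_eq_dvd_iff [symmetric])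
  then have "8 dvd (a' - a) + (c' - c)"
    by (rule dvd_add)
  then have "8 dvd (a' + c') - (a + c)"
    by (simp add: algebra_simps)
  then have "8 dvd ((a' + c') - (a + c)) * b"
    by (rule dvd_mult2)
  moreover have "(a + c) * (b + b') + 2 * m = 2 * (y * (x + z)) - ((a' + c') - (a + c)) * b"
    using corner by (simp add: algebra_simps)
  ultimately have main: "8 dvd (a + c) * (b + b') + 2 * m"
    using xz by (metis dvd_diff)
  have "4 dvd a + c"
    using a(1) c(1) by (simp add: dvd_eq_mod_eq_0 mod_add_eq[symmetric])
  then obtain s where s: "a + c = 4 * s"
    by (elim dvdE)
  have "8 dvd 4 * (s * (b + b')) + 2 * m"
    using main by (simp add: s mult.assoc)
  then have half: "4 dvd 2 * (s * (b + b')) + m"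
    by presburger
  then show "even m"
    by presburger
  show "odd (b + b')"
  proof
    assume "even (b + b')"
    then obtain h where "s * (b + b') = 2 * h"
      by (metis dvdE dvd_mult)
    with half have "4 dvd 2 * (2 * h) + m"
      by simp
    with m show False
      by presburger
  qed
qed

text \<open>Here \<open>a' + c'\<close> is twice an odd number while \<open>x + z\<close> is only known to be even, so halving the
  corner equation leaves \<open>b\<close> as the only term of undetermined parity.\<close>

lemma mixed_pair_corner_even:
  fixes a b c a' b' c' :: int
  assumes "a mod 4 = 2" "c mod 4 = 2" "4 dvd a'" "c' mod 4 = 2" "even m"
    and sq: "a * a' + (16 * k + 12) = x\<^sup>2" "c * c' + (16 * n + 12) = z\<^sup>2"
    and corner: "(a + c) * b' + (a' + c') * b + 2 * m = 2 * (y * (x + z))"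
  shows "even b"
proof -
  have "even a'" "even c"
    using assms(2,3) by presburger+
  then have "even (x\<^sup>2)" "even (z\<^sup>2)"
    using sq[symmetric] by simp_all
  then have "even (y * (x + z))"
    by simp
  then obtain h where h: "y * (x + z) = 2 * h"
    by (elim dvdE)
  have "4 dvd a + c"
    using assms(1,2) by (simp add: dvd_eq_mod_eq_0 mod_add_eq[symmetric])
  then obtain s where s: "a + c = 4 * s"
    by (elim dvdE)
  have "4 dvd a' + (c' - 2)"
    using assms(3,4) by (intro dvd_add) (simp_all add: mod_eq_dvd_iff[symmetric])
  then obtain r where r: "a' + c' = 4 * r + 2"
    by (elim dvdE) (simp add: algebra_simps)
  have "4 * (s * b') + 4 * (r * b) + 2 * b + 2 * m = 4 * h"
    using corner unfolding s r h by (simp add: algebra_simps)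
  then have "b = 2 * (h - s * b' - r * b) - m"
    by (simp add: algebra_simps)
  then show "even b"
    using \<open>even m\<close> by (metis dvd_diff dvd_triv_left)
qed

section \<open>Families of integer triples\<close>

text \<open>Indexing the entries by a set of size four, instead of collecting them in sets, keeps the
  count intact when different matrices share entries.\<close>

lemma no_triangular_family:
  fixes a b c :: "'i \<Rightarrow> int"
  assumes card: "card S = 4" and m: "\<not> 4 dvd m"
    and fam: "\<And>i j. i \<in> S \<Longrightarrow> j \<in> S \<Longrightarrow> i \<noteq> j \<Longrightarrow> \<exists>x y z.
      a i * a j + (16 * k + 12) = x\<^sup>2 \<and> c i * c j + (16 * n + 12) = z\<^sup>2 \<and>
      (a i + c i) * b j + (a j + c j) * b i + 2 * m = 2 * (y * (x + z))"
  shows False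
proof -
  obtain p u where p: "p \<in> S" "u mod 4 = 2" "\<And>i. i \<in> S - {p} \<Longrightarrow> a i mod 8 = u mod 8"
    "a p mod 8 = u mod 8 \<or> a p mod 8 = 4"
    using square_shifted_family_mod_8[OF card, of a k] fam by metis
  obtain q w where q: "q \<in> S" "w mod 4 = 2" "\<And>i. i \<in> S - {q} \<Longrightarrow> c i mod 8 = w mod 8"
    using square_shifted_family_mod_8[OF card, of c n] fam by metis
  define R where "R = {i \<in> S. a i mod 8 = u mod 8 \<and> c i mod 8 = w mod 8}"
  have mod4: "i mod 4 = v mod 4" if "i mod 8 = v mod 8" for i v :: int
    using arg_cong[OF that, of "\<lambda>r. r mod 4"] by (simp add: mod_mod_cancel)
  have R_mod4: "a i mod 4 = 2" "c i mod 4 = 2" if "i \<in> R" for i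
    using that mod4[of "a i" u] mod4[of "c i" w] p(2) q(2) by (simp_all add: R_def)
  have pair: "even m \<and> odd (b i + b j)" if "i \<in> R" "j \<in> R" "i \<noteq> j" for i j
  proof -
    obtain x y z where "a i * a j + (16 * k + 12) = x\<^sup>2" "c i * c j + (16 * n + 12) = z\<^sup>2"
      "(a i + c i) * b j + (a j + c j) * b i + 2 * m = 2 * (y * (x + z))"
      using fam[of i j] \<open>i \<in> R\<close> \<open>j \<in> R\<close> \<open>i \<noteq> j\<close> unfolding R_def by blast
    from regular_pair_corner_parity[OF R_mod4(1)[OF \<open>i \<in> R\<close>] _ R_mod4(2)[OF \<open>i \<in> R\<close>] _ this m]
    show ?thesis
      using that by (simp add: R_def)
  qed
  have no_three: False if "i \<in> R" "j \<in> R" "l \<in> R" "i \<noteq> j" "i \<noteq> l" "j \<noteq> l" for i j l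
    using pair[of i j] pair[of i l] pair[of j l] that by (simp add: even_add)
  have regular: "i \<in> R" if "i \<in> S - {p, q}" for i
    using that p(3) q(3) by (auto simp: R_def)
  show False
  proof (cases "p = q")
    case True
    then have "card (S - {p, q}) = 3"
      using card p(1) by simp
    then obtain i j l where "S - {p, q} = {i, j, l}" "i \<noteq> j" "i \<noteq> l" "j \<noteq> l"
      by (auto simp: card_3_iff)
    then show False
      using no_three[of i j l] regular by blast
  next
    case False
    have "card (S - {p, q}) = 2"
      using card p(1) q(1) False by (simp add: card_Diff_subset)
    then obtain i j where ij: "S - {p, q} = {i, j}" "i \<noteq> j"
      by (auto simp: card_2_iff)
    then have R: "i \<in> R" "j \<in> R"
      using regular by auto
    have cp: "c p mod 8 = w mod 8"
      using q(3) p(1) False by simp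
    show False
    proof (cases "a p mod 8 = u mod 8")
      case True
      then have "p \<in> R"
        using p(1) cp by (simp add: R_def)
      then show False
        using no_three[of i j p] R ij by blast
    next
      case a_p: False
      have "4 dvd a p"
        using a_p p(4) by presburger
      have "c p mod 4 = 2"
        using mod4[OF cp] q(2) by simp
      have "even m"
        using pair R ij by blast
      have "even (b l)" if "l \<in> {i, j}" for l
      proof -
        have l: "l \<in> R" "l \<in> S" "l \<noteq> p"
          using that R ij by auto
        obtain x y z where "a l * a p + (16 * k + 12) = x\<^sup>2" "c l * c p + (16 * n + 12) = z\<^sup>2"
          "(a l + c l) * b p + (a p + c p) * b l + 2 * m = 2 * (y * (x + z))"
          using fam[OF l(2) p(1) l(3)] by blast
        from mixed_pair_corner_even[OF R_mod4[OF l(1)] \<open>4 dvd a p\<close> \<open>c p mod 4 = 2\<close> \<open>even m\<close> this]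
        show ?thesis .
      qed
      then show False
        using pair[OF R ij(2)] by simp
    qed
  qed
qed

section \<open>From matrices to entries\<close>

lemma UT2_int_entries:
  assumes "A \<in> UT2_int"
  shows "A $ 1 $ 1 = of_int \<lfloor>A $ 1 $ 1\<rfloor>" "A $ 1 $ 2 = of_int \<lfloor>A $ 1 $ 2\<rfloor>"
    "A $ 2 $ 2 = of_int \<lfloor>A $ 2 $ 2\<rfloor>" "A $ 2 $ 1 = 0"
  using assms by (auto simp: UT2_int_def)

lemma jordan_prod_shift_square_entries:
  assumes A: "A \<in> UT2_int" and B: "B \<in> UT2_int" and X: "X \<in> UT2_int"
    and N: "N = vector [vector [of_int d, of_int m], vector [0, of_int e]]"
    and eq: "jordan_prod A B + N = X ** X"
  shows "\<lfloor>A $ 1 $ 1\<rfloor> * \<lfloor>B $ 1 $ 1\<rfloor> + d = \<lfloor>X $ 1 $ 1\<rfloor>\<^sup>2"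
    and "\<lfloor>A $ 2 $ 2\<rfloor> * \<lfloor>B $ 2 $ 2\<rfloor> + e = \<lfloor>X $ 2 $ 2\<rfloor>\<^sup>2"
    and "(\<lfloor>A $ 1 $ 1\<rfloor> + \<lfloor>A $ 2 $ 2\<rfloor>) * \<lfloor>B $ 1 $ 2\<rfloor> + (\<lfloor>B $ 1 $ 1\<rfloor> + \<lfloor>B $ 2 $ 2\<rfloor>) * \<lfloor>A $ 1 $ 2\<rfloor> + 2 * m
      = 2 * (\<lfloor>X $ 1 $ 2\<rfloor> * (\<lfloor>X $ 1 $ 1\<rfloor> + \<lfloor>X $ 2 $ 2\<rfloor>))"
proof -
  note entries = UT2_int_entries[OF A] UT2_int_entries[OF B] UT2_int_entries[OF X]
  have entry: "(jordan_prod A B + N) $ i $ j = (X ** X) $ i $ j" for i j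
    using eq by simp
  have *: "A $ 1 $ 1 * B $ 1 $ 1 + of_int d = (X $ 1 $ 1)\<^sup>2"
    "A $ 2 $ 2 * B $ 2 $ 2 + of_int e = (X $ 2 $ 2)\<^sup>2"
    "(A $ 1 $ 1 + A $ 2 $ 2) * B $ 1 $ 2 + (B $ 1 $ 1 + B $ 2 $ 2) * A $ 1 $ 2 + 2 * of_int m
      = 2 * (X $ 1 $ 2 * (X $ 1 $ 1 + X $ 2 $ 2))"
    using entry[of 1 1] entry[of 2 2] entry[of 1 2] entries(4,8,12)
    by (simp_all add: N jordan_prod_def matrix_matrix_mult_def sum_2 power2_eq_square field_simps)
  have "(of_int (\<lfloor>A $ 1 $ 1\<rfloor> * \<lfloor>B $ 1 $ 1\<rfloor> + d) :: rat) = of_int (\<lfloor>X $ 1 $ 1\<rfloor>\<^sup>2)"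
    using *(1) entries by simp
  then show "\<lfloor>A $ 1 $ 1\<rfloor> * \<lfloor>B $ 1 $ 1\<rfloor> + d = \<lfloor>X $ 1 $ 1\<rfloor>\<^sup>2"
    by (simp only: of_int_eq_iff)
  have "(of_int (\<lfloor>A $ 2 $ 2\<rfloor> * \<lfloor>B $ 2 $ 2\<rfloor> + e) :: rat) = of_int (\<lfloor>X $ 2 $ 2\<rfloor>\<^sup>2)"
    using *(2) entries by simp
  then show "\<lfloor>A $ 2 $ 2\<rfloor> * \<lfloor>B $ 2 $ 2\<rfloor> + e = \<lfloor>X $ 2 $ 2\<rfloor>\<^sup>2"
    by (simp only: of_int_eq_iff)
  have "(of_int ((\<lfloor>A $ 1 $ 1\<rfloor> + \<lfloor>A $ 2 $ 2\<rfloor>) * \<lfloor>B $ 1 $ 2\<rfloor>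
      + (\<lfloor>B $ 1 $ 1\<rfloor> + \<lfloor>B $ 2 $ 2\<rfloor>) * \<lfloor>A $ 1 $ 2\<rfloor> + 2 * m) :: rat)
    = of_int (2 * (\<lfloor>X $ 1 $ 2\<rfloor> * (\<lfloor>X $ 1 $ 1\<rfloor> + \<lfloor>X $ 2 $ 2\<rfloor>)))"
    using *(3) entries by simp
  then show "(\<lfloor>A $ 1 $ 1\<rfloor> + \<lfloor>A $ 2 $ 2\<rfloor>) * \<lfloor>B $ 1 $ 2\<rfloor>
      + (\<lfloor>B $ 1 $ 1\<rfloor> + \<lfloor>B $ 2 $ 2\<rfloor>) * \<lfloor>A $ 1 $ 2\<rfloor> + 2 * m
    = 2 * (\<lfloor>X $ 1 $ 2\<rfloor> * (\<lfloor>X $ 1 $ 1\<rfloor> + \<lfloor>X $ 2 $ 2\<rfloor>))"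
    by (simp only: of_int_eq_iff)
qed

theorem proposition15:
  fixes k n m :: int and N :: "rat^2^2"
  assumes "\<not> 4 dvd m"
    and "N = vector [vector [of_int (16 * k + 12), of_int m],
                     vector [0, of_int (16 * n + 12)]]"
  shows "\<not> (\<exists>S. jordan_D_quadruple N S)"
proof
  assume "\<exists>S. jordan_D_quadruple N S"
  then obtain S where S: "S \<subseteq> UT2_int" "card S = 4"
    and sq: "\<And>A B. A \<in> S \<Longrightarrow> B \<in> S \<Longrightarrow> A \<noteq> B \<Longrightarrow> \<exists>X\<in>UT2_int. jordan_prod A B + N = X ** X"
    unfolding jordan_D_quadruple_def by blast
  show False
  proof (rule no_triangular_family[OF S(2) assms(1), where a = "\<lambda>A. \<lfloor>A $ 1 $ 1\<rfloor>"
        and b = "\<lambda>A. \<lfloor>A $ 1 $ 2\<rfloor>" and c = "\<lambda>A. \<lfloor>A $ 2 $ 2\<rfloor>"])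
    fix A B
    assume AB: "A \<in> S" "B \<in> S" "A \<noteq> B"
    then obtain X where X: "X \<in> UT2_int" "jordan_prod A B + N = X ** X"
      using sq by blast
    have "A \<in> UT2_int" "B \<in> UT2_int"
      using AB S(1) by auto
    from jordan_prod_shift_square_entries[OF this X(1) assms(2) X(2)]
    show "\<exists>x y z. \<lfloor>A $ 1 $ 1\<rfloor> * \<lfloor>B $ 1 $ 1\<rfloor> + (16 * k + 12) = x\<^sup>2 \<and>
      \<lfloor>A $ 2 $ 2\<rfloor> * \<lfloor>B $ 2 $ 2\<rfloor> + (16 * n + 12) = z\<^sup>2 \<and>
      (\<lfloor>A $ 1 $ 1\<rfloor> + \<lfloor>A $ 2 $ 2\<rfloor>) * \<lfloor>B $ 1 $ 2\<rfloor> + (\<lfloor>B $ 1 $ 1\<rfloor> + \<lfloor>B $ 2 $ 2\<rfloor>) * \<lfloor>A $ 1 $ 2\<rfloor>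
        + 2 * m = 2 * (y * (x + z))"
      by blast
  qed
qed

end
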